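(* Let $a<b$, $T>1$, $\epsilon>0$, let $N,K\ge 1$ be integers, and let $a=a_0<a_1<\cdots<a_K=b$ be a partition of $[a,b]$. Let $P_{N,K}^{\epsilon}f$ be the local Fourier extension approximation of $f$ and $\mathcal{Q}_{N,K}^{\epsilon}(f)=\int_a^b (P_{N,K}^{\epsilon}f)(x)\,dx$ the local Fourier extension quadrature associated with this partition. Then for any $f\in L^2(a,b)$, $$\left|\int_a^b f(x)\,dx-\mathcal{Q}_{N,K}^{\epsilon}(f)\right|\le \sqrt{b-a}\,\|f-P_{N,K}^{\epsilon}f\|_{L^2(a,b)}.$$
   Context: Let $T>1$ and $\Lambda=[0,2\pi/T]$. For $|\ell|\le N$ let $\phi_\ell(t)=e^{i\ell t}$, and define the synthesis operator $\mathcal{F}_N:\mathbb{C}^{2N+1}\to L^2(\Lambda)$, $\mathcal{F}_N\mathbf{c}=\sum_{\ell=-N}^{N}c_\ell\phi_\ell$ for $\mathbf{c}=(c_\ell)_{|\ell|\le N}$; its range is $\Phi_N=\mathrm{span}\{\phi_\ell:|\ell|\le N\}$. Here $\mathbb{C}^{2N+1}$ carries the $\ell^2$ norm and $L^2(\Lambda)$ its usual inner product $\langle\cdot,\cdot\rangle$. Let $(\sigma_j,v_j,u_j)$ be a singular system of $\mathcal{F}_N$ (orthonormal $v_j\in\mathbb{C}^{2N+1}$, orthonormal $u_j\in L^2(\Lambda)$, $\mathcal{F}_Nv_j=\sigma_ju_j$, $\sigma_j>0$). Given a partition $a=a_0<\cdots<a_K=b$, set $I_k=[a_{k-1},a_k]$,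 $s_k=\frac{T}{2\pi}(a_k-a_{k-1})$, and $g_k(t)=f(a_{k-1}+s_kt)$ for $t\in\Lambda$, $k=1,\dots,K$. For a tolerance $\epsilon>0$ the truncated-SVD coefficient vector is $$\mathbf{c}_N^{\epsilon,k}=\sum_{\sigma_j>\epsilon}\frac{\langle g_k,u_j\rangle}{\sigma_j}v_j,$$ and $Q_N^\epsilon g_k=\mathcal{F}_N\mathbf{c}_N^{\epsilon,k}$. The local Fourier extension approximation of $f$ is defined piecewise by $$(P_{N,K}^{\epsilon}f)(x)=(Q_N^\epsilon g_k)\left(\frac{x-a_{k-1}}{s_k}\right),\qquad x\in I_k,\ k=1,\dots,K$$ (values at the finitely many common endpoints are irrelevant), and the quadrature is $\mathcal{Q}_{N,K}^{\epsilon}(f)=\int_a^b(P_{N,K}^{\epsilon}f)(x)\,dx$. *)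

theory Defs
  imports "HOL-Analysis.Analysis"
begin

text \<open>
  Elements of \<open>L\<^sup>2\<close> are represented by complex-valued functions, so that identities between
  elements of \<open>L\<^sup>2(S)\<close> are stated almost everywhere on \<open>S\<close>.
\<close>

definition L2_on :: "real set \<Rightarrow> (real \<Rightarrow> complex) set" where
  "L2_on S = {f. f \<in> borel_measurable (lebesgue_on S) \<and>
                 integrable (lebesgue_on S) (\<lambda>x. (cmod (f x))\<^sup>2)}"

definition L2_inner :: "real set \<Rightarrow> (real \<Rightarrow> complex) \<Rightarrow> (real \<Rightarrow> complex) \<Rightarrow> complex" where
  "L2_inner S f g = (LINT x|lebesgue_on S. f x * cnj (g x))"

definition L2_norm_on :: "real set \<Rightarrow> (real \<Rightarrow> complex) \<Rightarrow> real" where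
  "L2_norm_on S f = sqrt (LINT x|lebesgue_on S. (cmod (f x))\<^sup>2)"

definition Lam :: "real \<Rightarrow> real set" where
  "Lam T = {0..2 * pi / T}"

text \<open>
  A vector of \<open>\<complex>\<close> to the power \<open>2 N + 1\<close> is a function on the integers of which only the values
  at \<open>-N, \<dots>, N\<close> are used.
\<close>

definition coeff_inner :: "nat \<Rightarrow> (int \<Rightarrow> complex) \<Rightarrow> (int \<Rightarrow> complex) \<Rightarrow> complex" where
  "coeff_inner N c d = (\<Sum>l = - int N..int N. c l * cnj (d l))"

definition phi :: "int \<Rightarrow> real \<Rightarrow> complex" where
  "phi l t = exp (\<i> * of_int l * of_real t)"

definition synthesis :: "nat \<Rightarrow> (int \<Rightarrow> complex) \<Rightarrow> real \<Rightarrow> complex" where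
  "synthesis N c t = (\<Sum>l = - int N..int N. c l * phi l t)"

text \<open>
  The singular system has indices \<open>1, \<dots>, r\<close>. The last clause is the singular value
  decomposition of the synthesis operator; it says that the system is complete, which excludes
  proper subfamilies of singular triples.
\<close>

definition singular_system ::
  "real \<Rightarrow> nat \<Rightarrow> nat \<Rightarrow> (nat \<Rightarrow> real) \<Rightarrow> (nat \<Rightarrow> int \<Rightarrow> complex) \<Rightarrow> (nat \<Rightarrow> real \<Rightarrow> complex) \<Rightarrow> bool"
where
  "singular_system T N r \<sigma> v u \<longleftrightarrow>
     (\<forall>j\<in>{1..r}. \<sigma> j > 0) \<and>
     (\<forall>i\<in>{1..r}. \<forall>j\<in>{1..r}. coeff_inner N (v i) (v j) = (if i = j then 1 else 0)) \<and>
     (\<forall>j\<in>{1..r}. u j \<in> L2_on (Lam T)) \<and>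
     (\<forall>i\<in>{1..r}. \<forall>j\<in>{1..r}. L2_inner (Lam T) (u i) (u j) = (if i = j then 1 else 0)) \<and>
     (\<forall>j\<in>{1..r}. AE t in lebesgue_on (Lam T). synthesis N (v j) t = of_real (\<sigma> j) * u j t) \<and>
     (\<forall>c. AE t in lebesgue_on (Lam T).
        synthesis N c t = (\<Sum>j = 1..r. of_real (\<sigma> j) * coeff_inner N c (v j) * u j t))"

definition tsvd_coeffs ::
  "real \<Rightarrow> nat \<Rightarrow> (nat \<Rightarrow> real) \<Rightarrow> (nat \<Rightarrow> int \<Rightarrow> complex) \<Rightarrow> (nat \<Rightarrow> real \<Rightarrow> complex) \<Rightarrow> real \<Rightarrow>
   (real \<Rightarrow> complex) \<Rightarrow> int \<Rightarrow> complex"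
where
  "tsvd_coeffs T r \<sigma> v u \<epsilon> g l =
     (\<Sum>j\<in>{j\<in>{1..r}. \<sigma> j > \<epsilon>}. L2_inner (Lam T) g (u j) / of_real (\<sigma> j) * v j l)"

definition tsvd_approx ::
  "real \<Rightarrow> nat \<Rightarrow> nat \<Rightarrow> (nat \<Rightarrow> real) \<Rightarrow> (nat \<Rightarrow> int \<Rightarrow> complex) \<Rightarrow> (nat \<Rightarrow> real \<Rightarrow> complex) \<Rightarrow> real \<Rightarrow>
   (real \<Rightarrow> complex) \<Rightarrow> real \<Rightarrow> complex"
where
  "tsvd_approx T N r \<sigma> v u \<epsilon> g = synthesis N (tsvd_coeffs T r \<sigma> v u \<epsilon> g)"

definition is_partition :: "real \<Rightarrow> real \<Rightarrow> nat \<Rightarrow> (nat \<Rightarrow> real) \<Rightarrow> bool" where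
  "is_partition a b K p \<longleftrightarrow> p 0 = a \<and> p K = b \<and> (\<forall>k<K. p k < p (Suc k))"

definition piece :: "(nat \<Rightarrow> real) \<Rightarrow> nat \<Rightarrow> real set" where
  "piece p k = {p (k - 1)..p k}"

definition local_scale :: "real \<Rightarrow> (nat \<Rightarrow> real) \<Rightarrow> nat \<Rightarrow> real" where
  "local_scale T p k = T / (2 * pi) * (p k - p (k - 1))"

definition local_pullback ::
  "real \<Rightarrow> (nat \<Rightarrow> real) \<Rightarrow> (real \<Rightarrow> complex) \<Rightarrow> nat \<Rightarrow> real \<Rightarrow> complex"
where
  "local_pullback T p f k t = f (p (k - 1) + local_scale T p k * t)"

text \<open>
  A common endpoint of two pieces is assigned to the left one, and the approximation is extended
  by zero outside of the partitioned interval; neither choice matters.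
\<close>

definition local_FE_approx ::
  "real \<Rightarrow> nat \<Rightarrow> nat \<Rightarrow> (nat \<Rightarrow> real) \<Rightarrow> (nat \<Rightarrow> int \<Rightarrow> complex) \<Rightarrow> (nat \<Rightarrow> real \<Rightarrow> complex) \<Rightarrow> real \<Rightarrow>
   nat \<Rightarrow> (nat \<Rightarrow> real) \<Rightarrow> (real \<Rightarrow> complex) \<Rightarrow> real \<Rightarrow> complex"
where
  "local_FE_approx T N r \<sigma> v u \<epsilon> K p f x =
     (if \<exists>k\<in>{1..K}. x \<in> piece p k
      then let k = (LEAST k. k \<in> {1..K} \<and> x \<in> piece p k)
           in tsvd_approx T N r \<sigma> v u \<epsilon> (local_pullback T p f k)
                ((x - p (k - 1)) / local_scale T p k)
      else 0)"

definition local_FE_quadrature ::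
  "real \<Rightarrow> nat \<Rightarrow> nat \<Rightarrow> (nat \<Rightarrow> real) \<Rightarrow> (nat \<Rightarrow> int \<Rightarrow> complex) \<Rightarrow> (nat \<Rightarrow> real \<Rightarrow> complex) \<Rightarrow> real \<Rightarrow>
   nat \<Rightarrow> (nat \<Rightarrow> real) \<Rightarrow> (real \<Rightarrow> complex) \<Rightarrow> complex"
where
  "local_FE_quadrature T N r \<sigma> v u \<epsilon> K p f =
     (LINT x|lebesgue_on {p 0..p K}. local_FE_approx T N r \<sigma> v u \<epsilon> K p f x)"

end

theory Submission
  imports Defs
begin

text \<open>
  The error \<open>e = f - P f\<close> of the local approximation is square integrable: on each piece, \<open>P f\<close> is
  a trigonometric polynomial after an affine substitution, so it is measurable and bounded, and \<open>f\<close>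
  is square integrable by assumption.  On the finite interval \<open>[a, b]\<close> all three functions are
  therefore integrable, the quadrature error is the integral of \<open>e\<close>, and the Cauchy--Schwarz
  inequality against the constant function \<open>1\<close> bounds it by \<open>sqrt (b - a)\<close> times the \<open>L\<^sup>2\<close> norm
  of \<open>e\<close>.
\<close>

lemma (in finite_measure) integrable_if_norm_square_integrable:
  fixes g :: "'a \<Rightarrow> 'b::{banach, second_countable_topology}"
  assumes "g \<in> borel_measurable M" and "integrable M (\<lambda>x. (norm (g x))\<^sup>2)"
  shows "integrable M g"
proof (rule Bochner_Integration.integrable_bound)
  show "integrable M (\<lambda>x. 1 + (norm (g x))\<^sup>2)"
    using assms by simp
  have "norm (g x) \<le> 1 + (norm (g x))\<^sup>2" for x
    using zero_le_power2[of "norm (g x) - 1"] norm_ge_zero[of "g x"]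
    unfolding power2_diff one_power2 mult_1_right by linarith
  then show "AE x in M. norm (g x) \<le> norm (1 + (norm (g x))\<^sup>2)"
    by simp
qed (fact assms)

text \<open>The Cauchy--Schwarz inequality for \<open>norm \<circ> g\<close> and the constant function \<open>1\<close>.\<close>

lemma (in finite_measure) norm_integral_le_sqrt_measure_mult:
  fixes g :: "'a \<Rightarrow> 'b::{banach, second_countable_topology}"
  assumes "g \<in> borel_measurable M" and sq: "integrable M (\<lambda>x. (norm (g x))\<^sup>2)"
  shows "norm (integral\<^sup>L M g)
         \<le> sqrt (measure M (space M)) * sqrt (\<integral>x. (norm (g x))\<^sup>2 \<partial>M)"
proof -
  define m where "m = measure M (space M)"
  define I where "I = (\<integral>x. norm (g x) \<partial>M)"
  define E where "E = (\<integral>x. (norm (g x))\<^sup>2 \<partial>M)"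
  have int: "integrable M (\<lambda>x. norm (g x))"
    using integrable_if_norm_square_integrable[OF assms] by simp
  have "I\<^sup>2 \<le> m * E"
  proof (cases "m = 0")
    case True
    then have "emeasure M (space M) = 0"
      by (simp add: m_def emeasure_eq_measure)
    then have "AE x in M. norm (g x) = 0"
      by (intro AE_I[of _ _ "space M"]) auto
    then have "I = 0"
      unfolding I_def using integral_cong_AE[of _ M "\<lambda>_. 0::real"] assms by simp
    with True show ?thesis by simp
  next
    case False
    then have "m > 0"
      by (simp add: m_def zero_less_measure_iff)
    \<comment> \<open>The square of the deviation of \<open>m * norm (g x)\<close> from its mean \<open>I\<close> is nonnegative.\<close>
    have "0 \<le> (\<integral>x. (m * norm (g x) - I)\<^sup>2 \<partial>M)"
      by simp
    also have "\<dots> = (\<integral>x. m\<^sup>2 * (norm (g x))\<^sup>2 - 2 * m * I * norm (g x) + I\<^sup>2 \<partial>M)"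
      by (simp add: power2_diff power_mult_distrib algebra_simps)
    also have "\<dots> = m\<^sup>2 * E - 2 * m * I * I + m * I\<^sup>2"
      using int sq by (simp add: E_def I_def m_def)
    also have "\<dots> = m * (m * E - I\<^sup>2)"
      by (simp add: power2_eq_square algebra_simps)
    finally show ?thesis
      using \<open>m > 0\<close> by (simp add: zero_le_mult_iff)
  qed
  then have "I \<le> sqrt (m * E)"
    by (rule real_le_rsqrt)
  then have "I \<le> sqrt m * sqrt E"
    by (simp add: real_sqrt_mult)
  with integral_norm_bound[of M g] show ?thesis
    unfolding I_def m_def E_def by (rule order.trans)
qed

lemma borel_measurable_synthesis [measurable]: "synthesis N c \<in> borel_measurable borel"
  unfolding synthesis_def phi_def
  by (intro borel_measurable_continuous_onI continuous_intros)

lemma cmod_synthesis_le: "cmod (synthesis N c t) \<le> (\<Sum>l = - int N..int N. cmod (c l))"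
proof -
  have "cmod (phi l t) = 1" for l
    using norm_exp_i_times[of "of_int l * t"] by (simp add: phi_def mult.assoc)
  then show ?thesis
    unfolding synthesis_def
    by (intro order.trans[OF norm_sum]) (simp add: norm_mult)
qed

lemma borel_measurable_local_FE_approx:
  "local_FE_approx T N r \<sigma> v u \<epsilon> K p f \<in> borel_measurable borel"
proof -
  define Q where "Q k x = tsvd_approx T N r \<sigma> v u \<epsilon> (local_pullback T p f k)
      ((x - p (k - 1)) / local_scale T p k)" for k x
  define \<kappa> where "\<kappa> x = (LEAST k. k \<in> {1..K} \<and> x \<in> piece p k)" for x
  have [measurable]: "Measurable.pred borel (\<lambda>x. x \<in> piece p k)" for k
    by (simp add: piece_def)
  have \<kappa>: "\<kappa> \<in> measurable borel (count_space UNIV)"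
    unfolding \<kappa>_def[abs_def] by measurable
  have "Q k \<in> borel_measurable borel" for k
    unfolding Q_def[abs_def] tsvd_approx_def
    by (rule measurable_compose[OF _ borel_measurable_synthesis]) measurable
  \<comment> \<open>The index of the piece containing \<open>x\<close> is a measurable function with countable range, and for
    each fixed index the approximation is measurable.\<close>
  then have [measurable]: "(\<lambda>x. Q (\<kappa> x) x) \<in> borel_measurable borel"
    using \<kappa> by (rule measurable_compose_countable)
  have "local_FE_approx T N r \<sigma> v u \<epsilon> K p f =
      (\<lambda>x. if \<exists>k\<in>{1..K}. x \<in> piece p k then Q (\<kappa> x) x else 0)"
    by (simp only: local_FE_approx_def[abs_def] Let_def Q_def \<kappa>_def)
  moreover have "\<dots> \<in> borel_measurable borel"
    by measurable
  ultimately show ?thesis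
    by simp
qed

lemma bounded_local_FE_approx:
  "\<exists>B. \<forall>x. cmod (local_FE_approx T N r \<sigma> v u \<epsilon> K p f x) \<le> B"
proof -
  define c where "c k = tsvd_coeffs T r \<sigma> v u \<epsilon> (local_pullback T p f k)" for k
  define C where "C k = (\<Sum>l = - int N..int N. cmod (c k l))" for k
  have nonneg: "C k \<ge> 0" for k
    unfolding C_def by (simp add: sum_nonneg)
  have "cmod (local_FE_approx T N r \<sigma> v u \<epsilon> K p f x) \<le> sum C {1..K}" for x
  proof (cases "\<exists>k\<in>{1..K}. x \<in> piece p k")
    case True
    define k where "k = (LEAST k. k \<in> {1..K} \<and> x \<in> piece p k)"
    have k: "k \<in> {1..K}"
      unfolding k_def using True by (metis (mono_tags, lifting) LeastI)
    have "cmod (local_FE_approx T N r \<sigma> v u \<epsilon> K p f x) \<le> C k"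
      using True cmod_synthesis_le[of N "c k"]
      by (simp add: local_FE_approx_def tsvd_approx_def Let_def C_def c_def k_def)
    also have "\<dots> \<le> sum C {1..K}"
      using k nonneg by (intro member_le_sum) auto
    finally show ?thesis .
  next
    case False
    then show ?thesis
      by (simp add: local_FE_approx_def sum_nonneg nonneg)
  qed
  then show ?thesis by blast
qed

theorem theorem2p2:
  fixes a b T \<epsilon> :: real and N K r :: nat and p :: "nat \<Rightarrow> real"
    and \<sigma> :: "nat \<Rightarrow> real" and v :: "nat \<Rightarrow> int \<Rightarrow> complex" and u :: "nat \<Rightarrow> real \<Rightarrow> complex"
    and f :: "real \<Rightarrow> complex"
  assumes "a < b" and "T > 1" and "\<epsilon> > 0" and "N \<ge> 1" and "K \<ge> 1"
    and "is_partition a b K p"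
    and "singular_system T N r \<sigma> v u"
    and "f \<in> L2_on {a..b}"
  shows "cmod ((LINT x|lebesgue_on {a..b}. f x) - local_FE_quadrature T N r \<sigma> v u \<epsilon> K p f)
         \<le> sqrt (b - a) * L2_norm_on {a..b} (\<lambda>x. f x - local_FE_approx T N r \<sigma> v u \<epsilon> K p f x)"
proof -
  define M where "M = lebesgue_on {a..b}"
  define P where "P = local_FE_approx T N r \<sigma> v u \<epsilon> K p f"
  interpret finite_measure M
    unfolding M_def by (intro finite_measure_lebesgue_on) simp
  have f: "f \<in> borel_measurable M" "integrable M (\<lambda>x. (cmod (f x))\<^sup>2)"
    using assms(8) by (auto simp: L2_on_def M_def)
  obtain B where B: "\<And>x. cmod (P x) \<le> B"
    unfolding P_def using bounded_local_FE_approx by blast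
  have P: "P \<in> borel_measurable M"
    unfolding M_def P_def
    by (intro measurable_restrict_space1 measurable_completion)
       (simp add: borel_measurable_local_FE_approx)
  have intP: "integrable M P"
    using B P by (intro integrable_const_bound[where B = B]) auto
  have intf: "integrable M f"
    using f by (rule integrable_if_norm_square_integrable)
  have err: "(\<lambda>x. f x - P x) \<in> borel_measurable M"
    using f P by measurable
  have sq: "integrable M (\<lambda>x. (cmod (f x - P x))\<^sup>2)"
  proof (rule Bochner_Integration.integrable_bound)
    show "integrable M (\<lambda>x. 2 * (cmod (f x))\<^sup>2 + 2 * B\<^sup>2)"
      using f by simp
    show "(\<lambda>x. (cmod (f x - P x))\<^sup>2) \<in> borel_measurable M"
      using err by measurable
    have "(cmod (f x - P x))\<^sup>2 \<le> 2 * (cmod (f x))\<^sup>2 + 2 * B\<^sup>2" for x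
    proof -
      have "cmod (f x - P x) \<le> cmod (f x) + B"
        using norm_triangle_ineq4[of "f x" "P x"] B[of x] by linarith
      then have "(cmod (f x - P x))\<^sup>2 \<le> (cmod (f x) + B)\<^sup>2"
        by (intro power_mono) auto
      also have "\<dots> \<le> 2 * (cmod (f x))\<^sup>2 + 2 * B\<^sup>2"
        using zero_le_power2[of "cmod (f x) - B"] by (simp add: power2_sum power2_diff)
      finally show ?thesis .
    qed
    then show "AE x in M. norm ((cmod (f x - P x))\<^sup>2) \<le> norm (2 * (cmod (f x))\<^sup>2 + 2 * B\<^sup>2)"
      by simp
  qed
  have "local_FE_quadrature T N r \<sigma> v u \<epsilon> K p f = integral\<^sup>L M P"
    using assms(6) by (simp add: local_FE_quadrature_def is_partition_def M_def P_def)
  moreover have "measure M (space M) = b - a"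
    using \<open>a < b\<close> by (simp add: M_def measure_restrict_space)
  ultimately show ?thesis
    using norm_integral_le_sqrt_measure_mult[OF err sq] intf intP
    by (simp add: L2_norm_on_def M_def P_def)
qed

end
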